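(* There are no integers $x,y,z$ with $\gcd(x,y)=1$ satisfying $7x^2+y^6=4z^3$. *)

theory Defs
  imports Main
begin

end

theory Submission
  imports Defs
begin

text \<open>
  The obstruction is 7-adic. If 7 does not divide y then the sixth power of y is 1 modulo 7,
  while 4 times a cube is 0, 3 or 4 modulo 7. If 7 divides y, then it divides z, and
  comparing both sides modulo 49 shows that it also divides x, against coprimality.
\<close>

text \<open>An explicit finite set lets \<open>auto\<close> split into seven cases, each evaluated
  through \<open>power_mod\<close>.\<close>

lemma residues_mod_7: "(a :: int) mod 7 \<in> {0, 1, 2, 3, 4, 5, 6}"
  by (simp, presburger)

text \<open>By Fermat, the cube of a unit modulo 7 squares to 1, so it is 1 or -1. The first case
  keeps \<open>7 dvd a\<close>, so that a nonzero residue follows when 7 does not divide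
  \<open>a\<close>.\<close>

lemma cube_mod_7:
  fixes a :: int
  shows "7 dvd a \<and> a ^ 3 mod 7 = 0 \<or> a ^ 3 mod 7 = 1 \<or> a ^ 3 mod 7 = 6"
  using residues_mod_7[of a] power_mod[of a 7 3] by (auto simp: dvd_eq_mod_eq_0)

lemma sixth_power_mod_7:
  fixes a :: int
  shows "7 dvd a \<or> a ^ 6 mod 7 = 1"
  using residues_mod_7[of a] power_mod[of a 7 6] by (auto simp: dvd_eq_mod_eq_0)

lemma dvd_7_of_dvd_square:
  fixes a :: int
  assumes "7 dvd a ^ 2"
  shows "7 dvd a"
  using assms residues_mod_7[of a] power_mod[of a 7 2] by (auto simp: dvd_eq_mod_eq_0)

theorem theorem6:
  shows "\<not> (\<exists>x y z :: int. gcd x y = 1 \<and> 7 * x ^ 2 + y ^ 6 = 4 * z ^ 3)"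
proof
  assume "\<exists>x y z :: int. gcd x y = 1 \<and> 7 * x ^ 2 + y ^ 6 = 4 * z ^ 3"
  then obtain x y z :: int
    where coprime: "gcd x y = 1" and eq: "7 * x ^ 2 + y ^ 6 = 4 * z ^ 3"
    by (elim exE conjE)
  have "y ^ 6 mod 7 = (7 * x ^ 2 + y ^ 6) mod 7"
    by simp
  also have "\<dots> = 4 * (z ^ 3 mod 7) mod 7"
    unfolding eq by (rule mod_mult_right_eq[symmetric])
  finally have mod_7: "y ^ 6 mod 7 = 4 * (z ^ 3 mod 7) mod 7" .
  have y: "7 dvd y"
  proof (rule ccontr)
    assume "\<not> 7 dvd y"
    then have "y ^ 6 mod 7 = 1"
      using sixth_power_mod_7 by blast
    moreover have "z ^ 3 mod 7 = 0 \<or> z ^ 3 mod 7 = 1 \<or> z ^ 3 mod 7 = 6"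
      using cube_mod_7[of z] by blast
    ultimately show False
      using mod_7 by auto
  qed
  then obtain v where v: "y = 7 * v" ..
  have "7 dvd z"
  proof (rule ccontr)
    assume "\<not> 7 dvd z"
    then have "z ^ 3 mod 7 = 1 \<or> z ^ 3 mod 7 = 6"
      using cube_mod_7 by blast
    moreover have "y ^ 6 mod 7 = 0"
      using dvd_trans[OF y, of "y ^ 6"] by simp
    \<comment> \<open>The right side would be 4 or 3 modulo 7, the left side 0.\<close>
    ultimately show False
      using mod_7 by auto
  qed
  then obtain w where w: "z = 7 * w" ..
  \<comment> \<open>Substitution gives \<open>7 * x ^ 2 = 4 * 7 ^ 3 * w ^ 3 - 7 ^ 6 * v ^ 6\<close>;
    cancelling one 7 leaves a further factor 7, with 28 = 4 * 7 and 2401 = 7 ^ 4.\<close>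
  have "x ^ 2 = 7 * (28 * w ^ 3 - 2401 * v ^ 6)"
    using eq unfolding v w by (simp add: power_mult_distrib)
  then have "7 dvd x"
    using dvd_7_of_dvd_square[of x] by simp
  with y have "7 dvd gcd x y"
    by simp
  with coprime show False
    by simp
qed

end
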